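(* The function $h(t)=e^{1/t}-\psi'(t)$ is completely monotonic on $(0,\infty)$, and $\lim_{t\to\infty}h(t)=1$.
   Context: $\Gamma$ is the classical Euler gamma function, $\Gamma(z)=\int_0^\infty t^{z-1}e^{-t}\,dt$ for $\Re(z)>0$. The digamma function is $\psi(t)=[\ln\Gamma(t)]'=\Gamma'(t)/\Gamma(t)$, and its derivative $\psi'(t)$ is the trigamma function. An infinitely differentiable function $f$ defined on an interval $I$ is called completely monotonic on $I$ if $(-1)^k f^{(k)}(x)\ge 0$ for all $x\in I$ and all $k\in\{0\}\cup\mathbb{N}$. *)

theory Defs
  imports "HOL-Analysis.Analysis"
begin

text \<open>
  The function \<open>D k\<close> is the \<open>k\<close>-th derivative of \<open>f\<close> on \<open>I\<close>. Derivatives are taken relative to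
  \<open>I\<close>, hence one-sided at an endpoint that belongs to \<open>I\<close>; on an interval with more than one point
  they are uniquely determined. For open \<open>I\<close> they are the values of \<open>(deriv ^^ k) f\<close>, see
  \<open>completely_monotonic_on_open_iff\<close>.
\<close>

definition completely_monotonic_on :: "real set \<Rightarrow> (real \<Rightarrow> real) \<Rightarrow> bool" where
  "completely_monotonic_on I f \<longleftrightarrow>
     is_interval I \<and>
     (\<exists>D :: nat \<Rightarrow> real \<Rightarrow> real.
        (\<forall>x\<in>I. D 0 x = f x) \<and>
        (\<forall>k. \<forall>x\<in>I. (D k has_real_derivative D (Suc k) x) (at x within I)) \<and>
        (\<forall>k. \<forall>x\<in>I. (-1) ^ k * D k x \<ge> 0))"

lemma completely_monotonic_on_open_iff:
  assumes "open I"
  shows "completely_monotonic_on I f \<longleftrightarrow>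
     is_interval I \<and>
     (\<forall>k. \<forall>x\<in>I. (deriv ^^ k) f differentiable (at x)) \<and>
     (\<forall>k. \<forall>x\<in>I. (-1) ^ k * (deriv ^^ k) f x \<ge> 0)" (is "_ \<longleftrightarrow> ?R")
proof
  assume "completely_monotonic_on I f"
  then obtain D where int: "is_interval I" and D0: "\<And>x. x \<in> I \<Longrightarrow> D 0 x = f x"
    and D: "\<And>k x. x \<in> I \<Longrightarrow> (D k has_real_derivative D (Suc k) x) (at x)"
    and sgn: "\<And>k x. x \<in> I \<Longrightarrow> (-1) ^ k * D k x \<ge> 0"
    unfolding completely_monotonic_on_def using at_within_open[OF _ assms] by metis
  have step: "((deriv ^^ k) f has_real_derivative D (Suc k) x) (at x)"
    if "x \<in> I" "\<And>y. y \<in> I \<Longrightarrow> (deriv ^^ k) f y = D k y" for k x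
    using has_field_derivative_transform_within_open[OF D[OF that(1)] assms that(1)] that(2)
    by metis
  have eq: "(deriv ^^ k) f x = D k x" if "x \<in> I" for k x
    using that
  proof (induction k arbitrary: x)
    case 0
    then show ?case by (simp add: D0)
  next
    case (Suc k)
    then show ?case using DERIV_imp_deriv[OF step[of x k]] by simp
  qed
  show ?R
    using int sgn eq step by (metis real_differentiable_def)
next
  assume R: ?R
  have "((deriv ^^ k) f has_real_derivative (deriv ^^ Suc k) f x) (at x within I)"
    if "x \<in> I" for k x
  proof -
    have "(deriv ^^ k) f field_differentiable (at x)"
      using R that by (auto simp: real_differentiable_def field_differentiable_def)
    then have "((deriv ^^ k) f has_real_derivative deriv ((deriv ^^ k) f) x) (at x)"
      using DERIV_deriv_iff_field_differentiable by blast
    then show ?thesis by (simp add: has_field_derivative_at_within)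
  qed
  then show "completely_monotonic_on I f"
    unfolding completely_monotonic_on_def using R
    by (intro conjI exI[of _ "\<lambda>k. (deriv ^^ k) f"]) auto
qed

text \<open>The library introduces \<^const>\<open>Polygamma\<close> by a series; \<open>Digamma\<close> is \<open>[ln \<Gamma>]'\<close>:\<close>

lemma Digamma_eq_deriv_ln_Gamma:
  fixes t :: real
  assumes "t > 0"
  shows "Digamma t = deriv (\<lambda>x. ln (Gamma x)) t"
proof -
  have pos: "Gamma t > 0" using assms by (rule Gamma_real_pos)
  have "t \<notin> \<int>\<^sub>\<le>\<^sub>0" using assms by (auto elim!: nonpos_Ints_cases)
  then have "(Gamma has_real_derivative Gamma t * Digamma t) (at t)"
    by (rule has_field_derivative_Gamma)
  from DERIV_chain2[OF DERIV_ln_divide[OF pos] this]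
  have "((\<lambda>x. ln (Gamma x)) has_real_derivative 1 / Gamma t * (Gamma t * Digamma t)) (at t)" .
  also have "1 / Gamma t * (Gamma t * Digamma t) = Digamma t"
    using less_imp_neq[OF pos] by (metis mult.assoc mult_1 nonzero_divide_eq_eq)
  finally show ?thesis by (simp add: DERIV_imp_deriv)
qed

end

theory Submission
  imports Defs
begin

text \<open>
  Put \<open>y = 1/t\<close> and \<open>x = 1/(t+1)\<close>. The recurrence of the trigamma function gives
  \<open>h t - h (t+1) = exp y - exp x - y\<^sup>2\<close>. Since \<open>y - x = x y\<close>, the terms of degree at most 3 of
  the two exponential series combine with \<open>- y\<^sup>2\<close> to \<open>x\<^sup>3 y\<^sup>3 / 6\<close>, so that
  \<open>h t - h (t+1) = x\<^sup>3 y\<^sup>3 / 6 + (\<Sum>n\<ge>4. (y\<^sup>n - x\<^sup>n) / n!)\<close>, where every summand is completely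
  monotonic. All derivatives of \<open>h\<close> converge at infinity, \<open>h\<close> itself to 1 and the others to 0,
  and hence the signs carry over from the differences to \<open>h\<close>.
\<close>

section \<open>Closure properties of complete monotonicity\<close>

lemma completely_monotonic_onI:
  assumes "is_interval I"
    and "\<And>x. x \<in> I \<Longrightarrow> D 0 x = f x"
    and "\<And>k x. x \<in> I \<Longrightarrow> (D k has_real_derivative D (Suc k) x) (at x within I)"
    and "\<And>k x. x \<in> I \<Longrightarrow> (-1) ^ k * D k x \<ge> 0"
  shows "completely_monotonic_on I f"
  unfolding completely_monotonic_on_def using assms by blast

lemma completely_monotonic_onE:
  assumes "completely_monotonic_on I f"
  obtains D where "is_interval I"
    and "\<And>x. x \<in> I \<Longrightarrow> D 0 x = f x"
    and "\<And>k x. x \<in> I \<Longrightarrow> (D k has_real_derivative D (Suc k) x) (at x within I)"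
    and "\<And>k x. x \<in> I \<Longrightarrow> (-1) ^ k * D k x \<ge> 0"
  using assms unfolding completely_monotonic_on_def by blast

lemma completely_monotonic_on_cong:
  assumes "\<And>x. x \<in> I \<Longrightarrow> f x = g x"
  shows "completely_monotonic_on I f \<longleftrightarrow> completely_monotonic_on I g"
  unfolding completely_monotonic_on_def using assms by auto

lemma completely_monotonic_on_const:
  assumes "is_interval I" "c \<ge> 0"
  shows "completely_monotonic_on I (\<lambda>_. c)"
  by (rule completely_monotonic_onI[where D = "\<lambda>k _. if k = 0 then c else 0"]) (use assms in auto)

lemma completely_monotonic_on_add:
  assumes "completely_monotonic_on I f" "completely_monotonic_on I g"
  shows "completely_monotonic_on I (\<lambda>x. f x + g x)"
proof -
  from assms(1) obtain F where F: "is_interval I" "\<And>x. x \<in> I \<Longrightarrow> F 0 x = f x"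
    "\<And>k x. x \<in> I \<Longrightarrow> (F k has_real_derivative F (Suc k) x) (at x within I)"
    "\<And>k x. x \<in> I \<Longrightarrow> (-1) ^ k * F k x \<ge> 0"
    by (rule completely_monotonic_onE) blast
  from assms(2) obtain G where G: "\<And>x. x \<in> I \<Longrightarrow> G 0 x = g x"
    "\<And>k x. x \<in> I \<Longrightarrow> (G k has_real_derivative G (Suc k) x) (at x within I)"
    "\<And>k x. x \<in> I \<Longrightarrow> (-1) ^ k * G k x \<ge> 0"
    by (rule completely_monotonic_onE) blast
  show ?thesis
    by (rule completely_monotonic_onI[where D = "\<lambda>k x. F k x + G k x"])
       (use F G in \<open>auto intro!: DERIV_add simp: distrib_left\<close>)
qed

text \<open>With \<open>F\<close> and \<open>G\<close> the sequences of derivatives of \<open>f\<close> and \<open>g\<close>, this is the \<open>k\<close>-th derivative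
  of the product of the \<open>i\<close>-th derivative of \<open>f\<close> and the \<open>j\<close>-th derivative of \<open>g\<close>.\<close>

primrec deriv_prod ::
    "(nat \<Rightarrow> real \<Rightarrow> real) \<Rightarrow> (nat \<Rightarrow> real \<Rightarrow> real) \<Rightarrow> nat \<Rightarrow> nat \<Rightarrow> nat \<Rightarrow> real \<Rightarrow> real" where
  "deriv_prod F G 0 i j x = F i x * G j x"
| "deriv_prod F G (Suc k) i j x = deriv_prod F G k (Suc i) j x + deriv_prod F G k i (Suc j) x"

text \<open>For \<open>k = 0\<close> this is the product rule, and larger \<open>k\<close> follow by
  linearity. Keeping \<open>i\<close> and \<open>j\<close> arbitrary in the induction gives the
  Leibniz rule without binomial coefficients.\<close>

lemma has_real_derivative_deriv_prod:
  assumes "\<And>k. (F k has_real_derivative F (Suc k) x) (at x within I)"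
    and "\<And>k. (G k has_real_derivative G (Suc k) x) (at x within I)"
  shows "(deriv_prod F G k i j has_real_derivative deriv_prod F G (Suc k) i j x) (at x within I)"
proof (induction k arbitrary: i j)
  case 0
  have "((\<lambda>x. F i x * G j x) has_real_derivative F (Suc i) x * G j x + F i x * G (Suc j) x)
      (at x within I)"
    using DERIV_mult'[OF assms(1)[of i] assms(2)[of j]] by (simp add: add.commute)
  moreover have "deriv_prod F G 0 i j = (\<lambda>x. F i x * G j x)"
    by auto
  ultimately show ?case
    by simp
next
  case (Suc k)
  have "deriv_prod F G (Suc k) i j =
      (\<lambda>x. deriv_prod F G k (Suc i) j x + deriv_prod F G k i (Suc j) x)"
    by auto
  then show ?case
    using DERIV_add[OF Suc.IH[of "Suc i" j] Suc.IH[of i "Suc j"]] by simp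
qed

text \<open>In every summand \<open>F p x * G q x\<close> of the expansion the orders satisfy
  \<open>p + q = k + i + j\<close>, so all summands share one sign.\<close>

lemma deriv_prod_sign:
  assumes "\<And>k. (-1) ^ k * F k x \<ge> 0" "\<And>k. (-1) ^ k * G k x \<ge> 0"
  shows "(-1) ^ (k + i + j) * deriv_prod F G k i j x \<ge> 0"
proof (induction k arbitrary: i j)
  case 0
  show ?case
    using mult_nonneg_nonneg[OF assms(1)[of i] assms(2)[of j]]
    by (simp add: power_add mult_ac)
next
  case (Suc k)
  show ?case
    using add_nonneg_nonneg[OF Suc.IH[of "Suc i" j] Suc.IH[of i "Suc j"]]
    by (simp add: algebra_simps)
qed

lemma completely_monotonic_on_mult:
  assumes "completely_monotonic_on I f" "completely_monotonic_on I g"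
  shows "completely_monotonic_on I (\<lambda>x. f x * g x)"
proof -
  from assms(1) obtain F where F: "is_interval I" "\<And>x. x \<in> I \<Longrightarrow> F 0 x = f x"
    "\<And>k x. x \<in> I \<Longrightarrow> (F k has_real_derivative F (Suc k) x) (at x within I)"
    "\<And>k x. x \<in> I \<Longrightarrow> (-1) ^ k * F k x \<ge> 0"
    by (rule completely_monotonic_onE) blast
  from assms(2) obtain G where G: "\<And>x. x \<in> I \<Longrightarrow> G 0 x = g x"
    "\<And>k x. x \<in> I \<Longrightarrow> (G k has_real_derivative G (Suc k) x) (at x within I)"
    "\<And>k x. x \<in> I \<Longrightarrow> (-1) ^ k * G k x \<ge> 0"
    by (rule completely_monotonic_onE) blast
  show ?thesis
  proof (rule completely_monotonic_onI[where D = "\<lambda>k. deriv_prod F G k 0 0"])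
    show "(-1) ^ k * deriv_prod F G k 0 0 x \<ge> 0" if "x \<in> I" for k x
      using deriv_prod_sign[of F x G k 0 0] F(4) G(3) that by simp
  qed (use F G in \<open>auto intro!: has_real_derivative_deriv_prod simp del: deriv_prod.simps(2)\<close>)
qed

lemma completely_monotonic_on_power:
  assumes "completely_monotonic_on I f"
  shows "completely_monotonic_on I (\<lambda>x. f x ^ n)"
proof (induction n)
  case 0
  have "is_interval I"
    using assms by (simp add: completely_monotonic_on_def)
  then show ?case
    by (simp add: completely_monotonic_on_const)
next
  case (Suc n)
  then show ?case
    using completely_monotonic_on_mult[OF assms] by simp
qed

lemma completely_monotonic_on_inverse_shift:
  assumes "c \<ge> 0"
  shows "completely_monotonic_on {0<..} (\<lambda>t. 1 / (t + c))"
proof (rule completely_monotonic_onI[where D = "\<lambda>k t. (-1) ^ k * fact k / (t + c) ^ Suc k"])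
  show "((\<lambda>t. (-1) ^ k * fact k / (t + c) ^ Suc k) has_real_derivative
      (-1) ^ Suc k * fact (Suc k) / (t + c) ^ Suc (Suc k)) (at t within {0<..})"
    if "t \<in> {0<..}" for k t
  proof -
    have "t + c \<noteq> 0"
      using that assms by auto
    then show ?thesis
      by (auto intro!: derivative_eq_intros simp: divide_simps simp del: power_Suc)
         (simp add: algebra_simps)
  qed
  show "(-1) ^ k * ((-1) ^ k * fact k / (t + c) ^ Suc k) \<ge> 0" if "t \<in> {0<..}" for k t
    using that assms by (simp flip: mult.assoc power_mult_distrib)
qed (auto simp: is_interval_oi)

section \<open>From differences to the function\<close>

text \<open>By telescoping, \<open>D k t\<close> is the sum of the \<open>k\<close>-th derivatives of the difference at
  \<open>t, t + 1, \<dots>\<close> and the limit \<open>L k\<close>.\<close>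

lemma completely_monotonic_on_of_difference:
  fixes f :: "real \<Rightarrow> real" and D :: "nat \<Rightarrow> real \<Rightarrow> real"
  assumes diff: "completely_monotonic_on {0<..} (\<lambda>t. f t - f (t + 1))"
    and D0: "\<And>t. t > 0 \<Longrightarrow> D 0 t = f t"
    and D: "\<And>k t. t > 0 \<Longrightarrow> (D k has_real_derivative D (Suc k) t) (at t)"
    and lim: "\<And>k. (D k \<longlongrightarrow> L k) at_top"
    and L: "\<And>k. (-1) ^ k * L k \<ge> 0"
  shows "completely_monotonic_on {0<..} f"
proof -
  from diff obtain G where G0: "\<And>t. t > 0 \<Longrightarrow> G 0 t = f t - f (t + 1)"
    and G: "\<And>k t. t > 0 \<Longrightarrow> (G k has_real_derivative G (Suc k) t) (at t)"
    and G_sgn: "\<And>k t. t > 0 \<Longrightarrow> (-1) ^ k * G k t \<ge> 0"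
    by (rule completely_monotonic_onE) (force simp: at_within_open[of _ "{0<..}"])
  \<comment> \<open>The derivatives \<open>G\<close> are given only by existence. Uniqueness of
    derivatives on the open half-line identifies them with the differences of
    \<open>D\<close>.\<close>
  have GD: "G k t = D k t - D k (t + 1)" if "t > 0" for k t
    using that
  proof (induction k arbitrary: t)
    case 0
    then show ?case by (simp add: G0 D0)
  next
    case (Suc k)
    have "((\<lambda>t. D k (t + 1)) has_real_derivative D (Suc k) (t + 1)) (at t)"
      using D[of "t + 1" k] Suc.prems by (simp add: DERIV_shift)
    then have "((\<lambda>t. D k t - D k (t + 1)) has_real_derivative D (Suc k) t - D (Suc k) (t + 1)) (at t)"
      by (intro DERIV_diff D Suc.prems)
    then have "(G k has_real_derivative D (Suc k) t - D (Suc k) (t + 1)) (at t)"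
      by (rule has_field_derivative_transform_within_open[where S = "{0<..}"])
         (use Suc in auto)
    then show ?case
      using G[OF Suc.prems] DERIV_unique by blast
  qed
  have sgn: "(-1) ^ k * D k t \<ge> 0" if "t > 0" for k t
  proof -
    \<comment> \<open>Consecutive terms differ by a signed value of \<open>G\<close>, which is
      nonnegative; a decreasing sequence stays above its limit, here
      \<open>(-1) ^ k * L k\<close>.\<close>
    have dec: "decseq (\<lambda>n. (-1) ^ k * D k (t + real n))"
    proof (rule decseq_SucI)
      fix n
      have "0 \<le> (-1) ^ k * G k (t + real n)"
        using that by (intro G_sgn) simp
      also have "G k (t + real n) = D k (t + real n) - D k (t + real (Suc n))"
        using that by (subst GD) (simp_all add: add_ac)
      finally show "(-1) ^ k * D k (t + real (Suc n)) \<le> (-1) ^ k * D k (t + real n)"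
        by (simp add: algebra_simps)
    qed
    have "filterlim (\<lambda>n. t + real n) at_top sequentially"
      by (intro filterlim_tendsto_add_at_top[OF tendsto_const] filterlim_real_sequentially)
    from filterlim_compose[OF lim this]
    have "(\<lambda>n. (-1) ^ k * D k (t + real n)) \<longlonglongrightarrow> (-1) ^ k * L k"
      by (intro tendsto_intros)
    from decseq_ge[OF dec this, of 0] L[of k] show ?thesis
      by simp
  qed
  show ?thesis
    by (rule completely_monotonic_onI[where D = D])
       (use D0 D sgn in \<open>auto simp: is_interval_oi has_field_derivative_at_within\<close>)
qed

section \<open>Power series in \<open>1 / (t + c)\<close>\<close>

text \<open>The operator \<open>- d/dt\<close> on the coefficients of a power series in \<open>1 / (t + c)\<close>; for \<open>n = 0\<close> the
  truncated subtraction yields the coefficient 0.\<close>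

definition recip_diffs :: "(nat \<Rightarrow> real) \<Rightarrow> nat \<Rightarrow> real" where
  "recip_diffs a n = real (n - 1) * a (n - 1)"

text \<open>For \<open>z = 1 / (t + c)\<close> the derivative of \<open>z\<close> in
  \<open>t\<close> is \<open>- z\<^sup>2\<close>. By the chain rule, minus the
  \<open>t\<close>-derivative of the series is therefore \<open>z\<^sup>2\<close> times its
  \<open>z\<close>-derivative, and the factor \<open>z\<^sup>2\<close> shifts the coefficients of
  \<open>diffs a\<close> by two.\<close>

lemma recip_diffs_sums:
  assumes "\<And>z. summable (\<lambda>n. a n * z ^ n)"
  shows "(\<lambda>n. recip_diffs a n * z ^ n) sums (z\<^sup>2 * (\<Sum>n. diffs a n * z ^ n))"
proof -
  have "(\<lambda>n. z\<^sup>2 * (diffs a n * z ^ n)) sums (z\<^sup>2 * (\<Sum>n. diffs a n * z ^ n))"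
    by (intro sums_mult summable_sums termdiff_converges_all assms)
  also have "(\<lambda>n. z\<^sup>2 * (diffs a n * z ^ n)) = (\<lambda>n. recip_diffs a (n + 2) * z ^ (n + 2))"
    by (auto simp: recip_diffs_def diffs_def power_add power2_eq_square)
  \<comment> \<open>The coefficients at 0 and 1, skipped by the shift, both vanish.\<close>
  finally show ?thesis
    by (subst (asm) sums_iff_shift) (simp add: recip_diffs_def numeral_2_eq_2)
qed

lemma summable_recip_diffs_funpow:
  assumes "\<And>z. summable (\<lambda>n. a n * z ^ n)"
  shows "summable (\<lambda>n. (recip_diffs ^^ k) a n * z ^ n)"
  using assms by (induction k arbitrary: z) (auto intro: sums_summable[OF recip_diffs_sums])

lemma recip_diffs_funpow_nonneg:
  assumes "\<And>n. a n \<ge> 0"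
  shows "(recip_diffs ^^ k) a n \<ge> 0"
  using assms by (induction k arbitrary: n) (auto simp: recip_diffs_def)

lemma has_real_derivative_powser_recip:
  assumes "\<And>z. summable (\<lambda>n. a n * z ^ n)" "t + c \<noteq> 0"
  shows "((\<lambda>t. \<Sum>n. a n * (1 / (t + c)) ^ n) has_real_derivative
      - (\<Sum>n. recip_diffs a n * (1 / (t + c)) ^ n)) (at t)"
proof -
  have "((\<lambda>t. 1 / (t + c)) has_real_derivative - ((1 / (t + c))\<^sup>2)) (at t)"
    using assms(2) by (auto intro!: derivative_eq_intros simp: power2_eq_square)
  from DERIV_chain2[OF termdiffs_strong_converges_everywhere[OF assms(1)] this]
  show ?thesis
    using sums_unique[OF recip_diffs_sums[OF assms(1)], of "1 / (t + c)"]
    by (simp add: mult.commute)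
qed

lemma has_real_derivative_powser_recip_funpow:
  assumes "\<And>z. summable (\<lambda>n. a n * z ^ n)" "t + c \<noteq> 0"
  shows "((\<lambda>t. (-1) ^ k * (\<Sum>n. (recip_diffs ^^ k) a n * (1 / (t + c)) ^ n)) has_real_derivative
      (-1) ^ Suc k * (\<Sum>n. (recip_diffs ^^ Suc k) a n * (1 / (t + c)) ^ n)) (at t)"
  using DERIV_cmult[OF has_real_derivative_powser_recip[OF summable_recip_diffs_funpow[OF assms(1)]
      assms(2), of k], of "(-1) ^ k"]
  by simp

text \<open>All iterated coefficients stay nonnegative and \<open>1 / (t + c) \<le> 1 / t\<close>,
  so the two series for each signed derivative can be compared term by term.\<close>

lemma completely_monotonic_on_powser_recip_difference:
  assumes "\<And>z. summable (\<lambda>n. a n * z ^ n)" "\<And>n. a n \<ge> 0" "c \<ge> 0"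
  shows "completely_monotonic_on {0<..}
    (\<lambda>t. (\<Sum>n. a n * (1 / t) ^ n) - (\<Sum>n. a n * (1 / (t + c)) ^ n))"
proof (rule completely_monotonic_onI[where D = "\<lambda>k t.
    (-1) ^ k * (\<Sum>n. (recip_diffs ^^ k) a n * (1 / t) ^ n) -
    (-1) ^ k * (\<Sum>n. (recip_diffs ^^ k) a n * (1 / (t + c)) ^ n)"])
  fix k :: nat and t :: real
  assume t: "t \<in> {0<..}"
  show "((\<lambda>t. (-1) ^ k * (\<Sum>n. (recip_diffs ^^ k) a n * (1 / t) ^ n) -
      (-1) ^ k * (\<Sum>n. (recip_diffs ^^ k) a n * (1 / (t + c)) ^ n)) has_real_derivative
      (-1) ^ Suc k * (\<Sum>n. (recip_diffs ^^ Suc k) a n * (1 / t) ^ n) -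
      (-1) ^ Suc k * (\<Sum>n. (recip_diffs ^^ Suc k) a n * (1 / (t + c)) ^ n)) (at t within {0<..})"
    using has_real_derivative_powser_recip_funpow[OF assms(1), of t 0 k]
      has_real_derivative_powser_recip_funpow[OF assms(1), of t c k] t assms(3)
    by (intro has_field_derivative_at_within[OF DERIV_diff]) simp_all
  have "(\<Sum>n. (recip_diffs ^^ k) a n * (1 / (t + c)) ^ n) \<le>
      (\<Sum>n. (recip_diffs ^^ k) a n * (1 / t) ^ n)"
    using t assms(3)
    by (intro suminf_le summable_recip_diffs_funpow assms mult_left_mono power_mono
        recip_diffs_funpow_nonneg) (auto simp: frac_le)
  then show "(-1) ^ k * ((-1) ^ k * (\<Sum>n. (recip_diffs ^^ k) a n * (1 / t) ^ n) -
      (-1) ^ k * (\<Sum>n. (recip_diffs ^^ k) a n * (1 / (t + c)) ^ n)) \<ge> 0"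
    by (simp add: right_diff_distrib flip: mult.assoc power_mult_distrib)
qed (auto simp: is_interval_oi)

section \<open>Limits at infinity\<close>

lemma tendsto_powser_recip_at_top:
  fixes a :: "nat \<Rightarrow> real"
  assumes "\<And>z. summable (\<lambda>n. a n * z ^ n)"
  shows "((\<lambda>t. \<Sum>n. a n * (1 / t) ^ n) \<longlongrightarrow> a 0) at_top"
proof -
  have "((\<lambda>t. 1 / t) \<longlongrightarrow> (0::real)) at_top"
    by (intro tendsto_divide_0[OF tendsto_const] filterlim_at_top_imp_at_infinity filterlim_ident)
  from isCont_tendsto_compose[OF isCont_powser_converges_everywhere[OF assms] this]
  show ?thesis
    by simp
qed

lemma tendsto_Polygamma_at_top:
  assumes "n > 0"
  shows "(Polygamma n \<longlongrightarrow> (0::real)) at_top"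
proof -
  \<comment> \<open>Up to the factor \<open>(-1) ^ Suc n * fact n\<close>, this is the series of
    \<open>Polygamma n\<close>; \<open>n > 0\<close> makes the exponent at least 2, hence the series
    convergent.\<close>
  define Q :: "real \<Rightarrow> real" where "Q x = (\<Sum>k. inverse ((x + real k) ^ Suc n))" for x
  have sm: "summable (\<lambda>k. inverse ((x + real k) ^ Suc n))" if "x > 0" for x :: real
    using Polygamma_converges'[of x "Suc n"] that assms by simp
  \<comment> \<open>At integer points, \<open>Q (1 + real m)\<close> is a tail of the convergent
    series \<open>Q 1\<close>.\<close>
  have "(\<lambda>m. \<Sum>k. inverse ((1 + real (k + m)) ^ Suc n)) \<longlonglongrightarrow> 0"
    by (rule suminf_exist_split2[OF sm]) simp
  then have "(\<lambda>m. Q (1 + real m)) \<longlonglongrightarrow> 0"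
    by (simp add: Q_def add_ac)
  moreover have "filterlim (\<lambda>x::real. nat \<lfloor>x - 1\<rfloor>) sequentially at_top"
    by (intro filterlim_compose[OF filterlim_nat_sequentially]
        filterlim_compose[OF filterlim_floor_sequentially])
       (use filterlim_tendsto_add_at_top[OF tendsto_const filterlim_ident, of "-1"] in simp)
  ultimately have lim: "((\<lambda>x::real. Q (1 + real (nat \<lfloor>x - 1\<rfloor>))) \<longlongrightarrow> 0) at_top"
    by (rule filterlim_compose)
  \<comment> \<open>Each term of \<open>Q\<close> decreases in \<open>x\<close>, so for
    \<open>x \<ge> 1\<close> the value \<open>Q x\<close> is at most the value at the integer part
    of \<open>x\<close>, which is \<open>1 + real (nat \<lfloor>x - 1\<rfloor>)\<close>.\<close>
  have "(Q \<longlongrightarrow> 0) at_top"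
  proof (rule tendsto_sandwich[OF _ _ tendsto_const lim])
    show "\<forall>\<^sub>F x in at_top. 0 \<le> Q x"
      using eventually_gt_at_top[of 0]
      unfolding Q_def by eventually_elim (intro suminf_nonneg sm; simp)
    show "\<forall>\<^sub>F x in at_top. Q x \<le> Q (1 + real (nat \<lfloor>x - 1\<rfloor>))"
      using eventually_ge_at_top[of 1]
    proof eventually_elim
      case (elim x)
      then have "1 + real (nat \<lfloor>x - 1\<rfloor>) \<le> x"
        by linarith
      then show ?case
        unfolding Q_def using elim
        by (intro suminf_le sm le_imp_inverse_le power_mono zero_less_power; linarith)
    qed
  qed
  from tendsto_mult_right_zero[OF this, of "(-1) ^ Suc n * fact n"]
  show ?thesis
    using assms by (simp add: Q_def Polygamma_def[abs_def])
qed

section \<open>The difference \<open>h t - h (t + 1)\<close> and the conclusion for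
  \<open>h\<close>\<close>

lemma powser_exp_tail:
  "(\<lambda>n. (if n < m then 0 else inverse (fact n)) * z ^ n) sums
    (exp z - (\<Sum>n<m. inverse (fact n) * z ^ n))" for z :: real
proof -
  have "(\<lambda>n. inverse (fact n) * z ^ n - (if n \<in> {..<m} then inverse (fact n) * z ^ n else 0)) sums
      (exp z - (\<Sum>n<m. inverse (fact n) * z ^ n))"
    using exp_converges[of z] by (intro sums_diff sums_If_finite_set) simp_all
  moreover have "(\<lambda>n. inverse (fact n) * z ^ n -
      (if n \<in> {..<m} then inverse (fact n) * z ^ n else 0)) =
      (\<lambda>n. (if n < m then 0 else inverse (fact n)) * z ^ n)"
    by auto
  ultimately show ?thesis
    by simp
qed

lemma completely_monotonic_on_exp_recip_difference:
  "completely_monotonic_on {0<..} (\<lambda>t::real. exp (1 / t) - exp (1 / (t + 1)) - 1 / t\<^sup>2)"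
proof -
  \<comment> \<open>These are the exponential coefficients from degree 4 on; the cubic part, whose
    interplay with \<open>- 1 / t\<^sup>2\<close> matters, is treated separately.\<close>
  define e :: "nat \<Rightarrow> real" where "e n = (if n < 4 then 0 else inverse (fact n))" for n
  have e: "(\<lambda>n. e n * z ^ n) sums (exp z - (\<Sum>n<4. inverse (fact n) * z ^ n))" for z
    unfolding e_def by (rule powser_exp_tail)
  have "completely_monotonic_on {0<..}
      (\<lambda>t. (\<Sum>n. e n * (1 / t) ^ n) - (\<Sum>n. e n * (1 / (t + 1)) ^ n))"
    using e by (intro completely_monotonic_on_powser_recip_difference)
      (auto simp: sums_iff e_def)
  \<comment> \<open>Writing \<open>t + 0\<close> lets the shifted reciprocal lemma apply with
    \<open>c = 0\<close>.\<close>
  moreover have "completely_monotonic_on {0<..}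
      (\<lambda>t. 1 / 6 * ((1 / (t + 1)) ^ 3 * (1 / (t + 0)) ^ 3))"
    by (intro completely_monotonic_on_mult completely_monotonic_on_power
        completely_monotonic_on_inverse_shift completely_monotonic_on_const)
       (auto simp: is_interval_oi)
  ultimately have "completely_monotonic_on {0<..}
      (\<lambda>t. ((\<Sum>n. e n * (1 / t) ^ n) - (\<Sum>n. e n * (1 / (t + 1)) ^ n)) +
        1 / 6 * ((1 / (t + 1)) ^ 3 * (1 / (t + 0)) ^ 3))"
    by (rule completely_monotonic_on_add)
  also have "?this \<longleftrightarrow> ?thesis"
  proof (rule completely_monotonic_on_cong)
    fix t :: real
    assume "t \<in> {0<..}"
    define y x where "y = 1 / t" and "x = 1 / (t + 1)"
    have xy: "x * y = y - x"
      using \<open>t \<in> _\<close> by (simp add: x_def y_def field_simps)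
    have P: "(\<Sum>n<4. inverse (fact n) * z ^ n) = 1 + z + z\<^sup>2 / 2 + z ^ 3 / 6" for z :: real
      by (simp add: numeral_eq_Suc field_simps)
    have sq: "(y - x)\<^sup>2 = y\<^sup>2 + x\<^sup>2 - 2 * (y - x)"
      unfolding power2_diff using xy by (simp add: mult.assoc mult.commute)
    \<comment> \<open>Replacing \<open>x * y\<close> by \<open>y - x\<close> turns the mixed term of
      the cube into \<open>3 * (y - x)\<^sup>2\<close>, and \<open>sq\<close> then removes its own
      mixed term. Division by 6 leaves exactly the cubic Taylor parts, with
      \<open>- y\<^sup>2 / 2\<close> arising as \<open>y\<^sup>2 / 2 - y\<^sup>2\<close>.\<close>
    have "x ^ 3 * y ^ 3 = (y - x) ^ 3"
      by (simp flip: power_mult_distrib add: xy)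
    also have "\<dots> = y ^ 3 - x ^ 3 - 3 * ((x * y) * (y - x))"
      by (simp add: power3_eq_cube algebra_simps)
    also have "\<dots> = y ^ 3 - x ^ 3 - 3 * (y\<^sup>2 + x\<^sup>2 - 2 * (y - x))"
      using sq by (simp add: xy power2_eq_square)
    finally have "(y + y\<^sup>2 / 2 + y ^ 3 / 6) - (x + x\<^sup>2 / 2 + x ^ 3 / 6) - y\<^sup>2 = 1 / 6 * (x ^ 3 * y ^ 3)"
      by (simp add: field_simps)
    moreover have "1 / t\<^sup>2 = y\<^sup>2"
      by (simp add: y_def power_one_over)
    moreover have E: "(\<Sum>n. e n * z ^ n) = exp z - (1 + z + z\<^sup>2 / 2 + z ^ 3 / 6)" for z
      using sums_unique[OF e, of z] by (simp add: P)
    ultimately show "((\<Sum>n. e n * (1 / t) ^ n) - (\<Sum>n. e n * (1 / (t + 1)) ^ n)) +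
        1 / 6 * ((1 / (t + 1)) ^ 3 * (1 / (t + 0)) ^ 3) =
        exp (1 / t) - exp (1 / (t + 1)) - 1 / t\<^sup>2"
      unfolding add_0_right x_def[symmetric] y_def[symmetric] E by linarith
  qed
  finally show ?thesis .
qed

theorem theorem1p1:
  fixes h :: "real \<Rightarrow> real"
  assumes h: "\<And>t. t > 0 \<Longrightarrow> h t = exp (1 / t) - deriv Digamma t"
  shows "completely_monotonic_on {0<..} h \<and> (h \<longlongrightarrow> 1) at_top"
proof -
  define a :: "nat \<Rightarrow> real" where "a n = inverse (fact n)" for n
  have a: "(\<lambda>n. a n * z ^ n) sums exp z" for z
    using exp_converges[of z] by (simp add: a_def)
  have sm: "summable (\<lambda>n. a n * z ^ n)" for z
    using a sums_summable by blast
  \<comment> \<open>Candidate derivatives of \<open>h\<close>: the first term differentiates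
    \<open>exp (1 / t)\<close>, and \<open>Polygamma (Suc k)\<close> is the \<open>k\<close>-th
    derivative of the trigamma function \<open>Polygamma 1\<close>.\<close>
  define D :: "nat \<Rightarrow> real \<Rightarrow> real" where "D k t =
    (-1) ^ k * (\<Sum>n. (recip_diffs ^^ k) a n * (1 / t) ^ n) - Polygamma (Suc k) t" for k t
  have nonpos: "t \<notin> \<int>\<^sub>\<le>\<^sub>0" if "t > 0" for t :: real
    using that by (auto elim!: nonpos_Ints_cases)
  have h_eq: "h t = exp (1 / t) - Polygamma 1 t" if "t > 0" for t
    using deriv_Polygamma[OF nonpos[OF that], of 0] h[OF that] by simp
  have D0: "D 0 t = h t" if "t > 0" for t
    using sums_unique[OF a, of "1 / t"] that by (simp add: D_def h_eq)
  have lim: "(D k \<longlongrightarrow> (if k = 0 then 1 else 0)) at_top" for k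
  proof -
    have "(D k \<longlongrightarrow> (-1) ^ k * (recip_diffs ^^ k) a 0 - 0) at_top"
      unfolding D_def[abs_def]
      by (intro tendsto_intros tendsto_powser_recip_at_top summable_recip_diffs_funpow sm
          tendsto_Polygamma_at_top) simp
    \<comment> \<open>The constant coefficient is 1 for the exponential series and 0 after any
      application of \<open>recip_diffs\<close>.\<close>
    also have "(-1) ^ k * (recip_diffs ^^ k) a 0 - 0 = (if k = 0 then 1 else 0)"
      by (cases k) (simp_all add: a_def recip_diffs_def)
    finally show ?thesis .
  qed
  have "completely_monotonic_on {0<..} h"
  proof (rule completely_monotonic_on_of_difference[where D = D, OF _ D0 _ lim])
    \<comment> \<open>The trigamma recurrence
      \<open>Polygamma 1 (t + 1) = Polygamma 1 t - 1 / t\<^sup>2\<close> supplies the last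
      term.\<close>
    have "h t - h (t + 1) = exp (1 / t) - exp (1 / (t + 1)) - 1 / t\<^sup>2" if "t > 0" for t
      using that Polygamma_plus1[of t 1] by (simp add: h_eq power2_eq_square)
    then show "completely_monotonic_on {0<..} (\<lambda>t. h t - h (t + 1))"
      using completely_monotonic_on_exp_recip_difference
      by (subst completely_monotonic_on_cong) auto
    show "(D k has_real_derivative D (Suc k) t) (at t)" if "t > 0" for k t
      unfolding D_def[abs_def]
      using has_real_derivative_powser_recip_funpow[OF sm, of t 0 k] nonpos[OF that] that
      by (intro DERIV_diff has_field_derivative_Polygamma) simp_all
  qed auto
  moreover have "(h \<longlongrightarrow> 1) at_top"
  proof -
    \<comment> \<open>\<open>h\<close> is prescribed only for positive arguments, so the limit is
      transferred from \<open>D 0\<close> by eventual equality.\<close>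
    have "\<forall>\<^sub>F t in at_top. D 0 t = h t"
      using eventually_gt_at_top[of 0] by eventually_elim (rule D0)
    then show ?thesis
      using lim[of 0] by (simp add: tendsto_cong)
  qed
  ultimately show ?thesis ..
qed

end
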